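(* For $n=6,7,8$ the map $G':\mathcal M'\to Q$ defined in the context is bijective.
   Context: Let $n\in\{6,7,8\}$, $I=\{1,\dots,n\}$. Put $I_0=\{1,3,6\}$, $I_1=\{2,4,5\}$, $k=4$, $k'=3$ for $n=6$; $I_0=\{2,4,5,7\}$, $I_1=\{1,3,6\}$, $k=1$, $k'=2$ for $n=7$; $I_0=\{2,4,5,7\}$, $I_1=\{1,3,6,8\}$, $k=8$, $k'=7$ for $n=8$ (so $k'=k+(-1)^{n+1}$). Let $V=\{(i,1),(i,3):i\in I_0\}\cup\{(j,0),(j,2):j\in I_1\}\cup\{(k,4)\}$ and let $i_a$ ($(i,a)\in V$) be commuting indeterminates; $\mathcal M$ is the set of monomials (nonnegative exponents) in them. Put $F_i=i_1i_3$ ($i\in I_0$), $F_i=i_0i_2$ ($i\in I_1\setminus\{k\}$), $F_k=k_0k_2k_4$; $\mathcal M'\subset\mathcal M$ is the set of monomials not divisible by any $F_i$. Let $Q=\bigoplus_{i=0}^n\mathbb Z\alpha_i$ (the root lattice of $E_n^{(1)}$). Every $m\in\mathcal M$ has a unique expression with nonnegative integer exponents $$m=\prod_{i\in I}F_i^{a_i}\prod_{i\in I_0}i_1^{p_i}i_3^{q_i}\prod_{j\in I_1\setminus\{k\}}j_2^{p_j}j_0^{q_j}\cdot(k_2k_4)^p(k_0k_4)^q(k_0k_2)^r\,k_0^sk_2^tk_4^u$$ such that each of the tuples $(p_i,q_i)$ ($i\in I\setminus\{k\}$), $(p,q,r)$, $(s,t,u)$, $(p,s)$, $(q,t)$, $(r,u)$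 has at most one nonzero entry. Define $G:\mathcal M\to Q$ by $$G(m)=\sum_{i\in I\setminus\{k\}}(q_i-p_i)\alpha_i-p\,\alpha_0+q(\alpha_0+2\alpha_k+\alpha_{k'})+r\alpha_0+s(\alpha_0+\alpha_k)-t\,\alpha_k+u(\alpha_k+\alpha_{k'}).$$ Let $G'$ be the restriction of $G$ to $\mathcal M'$. *)

theory Defs
  imports "HOL-Library.Multiset" "HOL-Library.FuncSet" "HOL-Library.Poly_Mapping"
begin

text \<open>All definitions depending on \<open>n\<close> are only meaningful for \<open>n \<in> {6, 7, 8}\<close>.\<close>

definition idx :: "nat \<Rightarrow> nat set"
  where "idx n = {1..n}"

definition idx0 :: "nat \<Rightarrow> nat set"
  where "idx0 n = (if n = 6 then {1, 3, 6} else {2, 4, 5, 7})"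

definition idx1 :: "nat \<Rightarrow> nat set"
  where "idx1 n = (if n = 6 then {2, 4, 5} else if n = 7 then {1, 3, 6} else {1, 3, 6, 8})"

definition kk :: "nat \<Rightarrow> nat"
  where "kk n = (if n = 6 then 4 else if n = 7 then 1 else 8)"

definition kk' :: "nat \<Rightarrow> nat"
  where "kk' n = (if n = 6 then 3 else if n = 7 then 2 else 7)"

definition vars :: "nat \<Rightarrow> (nat \<times> nat) set"
  where "vars n = idx0 n \<times> {1, 3} \<union> idx1 n \<times> {0, 2} \<union> {(kk n, 4)}"

text \<open>
  A monomial in commuting indeterminates is a finite multiset of indeterminates, the pair
  \<open>(i, a)\<close> standing for the indeterminate \<open>i\<^sub>a\<close>. Products of monomials are thus written
  additively, the \<open>c\<close>-th power of \<open>m\<close> is \<open>repeat_mset c m\<close>, and divisibility is \<open>\<subseteq>#\<close>.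
\<close>

type_synonym monomial = "(nat \<times> nat) multiset"

definition monomials :: "nat \<Rightarrow> monomial set"
  where "monomials n = {m. set_mset m \<subseteq> vars n}"

definition F :: "nat \<Rightarrow> nat \<Rightarrow> monomial"
  where "F n i =
    (if i \<in> idx0 n then {#(i, 1), (i, 3)#}
     else if i = kk n then {#(i, 0), (i, 2), (i, 4)#}
     else {#(i, 0), (i, 2)#})"

definition monomials' :: "nat \<Rightarrow> monomial set"
  where "monomials' n = {m \<in> monomials n. \<forall>i\<in>idx n. \<not> F n i \<subseteq># m}"

text \<open>The free abelian group on \<open>\<alpha>\<^sub>0, \<dots>, \<alpha>\<^sub>n\<close>, where \<open>\<alpha>\<^sub>i\<close> is \<open>frag_of i\<close>.\<close>

definition root_lattice :: "nat \<Rightarrow> (nat \<Rightarrow>\<^sub>0 int) set"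
  where "root_lattice n = {x. Poly_Mapping.keys x \<subseteq> {0..n}}"

definition at_most_one_nonzero :: "nat list \<Rightarrow> bool"
  where "at_most_one_nonzero xs \<longleftrightarrow> length (filter (\<lambda>x. x \<noteq> 0) xs) \<le> 1"

text \<open>
  In the two definitions below, \<open>ps\<close> and \<open>qs\<close> are the families \<open>(p\<^sub>i)\<close> and \<open>(q\<^sub>i)\<close>
  (relevant on \<open>idx n - {kk n}\<close> only), and \<open>p\<close>, \<open>q\<close> are the exponents without index.
\<close>

definition is_expression ::
    "nat \<Rightarrow> monomial \<Rightarrow> (nat \<Rightarrow> nat) \<Rightarrow> (nat \<Rightarrow> nat) \<Rightarrow> (nat \<Rightarrow> nat) \<Rightarrow>
      nat \<Rightarrow> nat \<Rightarrow> nat \<Rightarrow> nat \<Rightarrow> nat \<Rightarrow> nat \<Rightarrow> bool"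
  where "is_expression n m a ps qs p q r s t u \<longleftrightarrow>
    m = (\<Sum>i\<in>idx n. repeat_mset (a i) (F n i))
      + (\<Sum>i\<in>idx0 n. repeat_mset (ps i) {#(i, 1)#} + repeat_mset (qs i) {#(i, 3)#})
      + (\<Sum>j\<in>idx1 n - {kk n}. repeat_mset (ps j) {#(j, 2)#} + repeat_mset (qs j) {#(j, 0)#})
      + repeat_mset p {#(kk n, 2), (kk n, 4)#}
      + repeat_mset q {#(kk n, 0), (kk n, 4)#}
      + repeat_mset r {#(kk n, 0), (kk n, 2)#}
      + repeat_mset s {#(kk n, 0)#} + repeat_mset t {#(kk n, 2)#} + repeat_mset u {#(kk n, 4)#}
    \<and> (\<forall>i\<in>idx n - {kk n}. at_most_one_nonzero [ps i, qs i])
    \<and> at_most_one_nonzero [p, q, r]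
    \<and> at_most_one_nonzero [s, t, u]
    \<and> at_most_one_nonzero [p, s]
    \<and> at_most_one_nonzero [q, t]
    \<and> at_most_one_nonzero [r, u]"

definition G_value ::
    "nat \<Rightarrow> (nat \<Rightarrow> nat) \<Rightarrow> (nat \<Rightarrow> nat) \<Rightarrow> nat \<Rightarrow> nat \<Rightarrow> nat \<Rightarrow> nat \<Rightarrow> nat \<Rightarrow> nat \<Rightarrow> (nat \<Rightarrow>\<^sub>0 int)"
  where "G_value n ps qs p q r s t u =
    (\<Sum>i\<in>idx n - {kk n}. frag_cmul (int (qs i) - int (ps i)) (frag_of i))
    - frag_cmul (int p) (frag_of 0)
    + frag_cmul (int q) (frag_of 0 + frag_cmul 2 (frag_of (kk n)) + frag_of (kk' n))
    + frag_cmul (int r) (frag_of 0)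
    + frag_cmul (int s) (frag_of 0 + frag_of (kk n))
    - frag_cmul (int t) (frag_of (kk n))
    + frag_cmul (int u) (frag_of (kk n) + frag_of (kk' n))"

lemma at_most_one_nonzero_iff:
  "at_most_one_nonzero [x, y] \<longleftrightarrow> x = 0 \<or> y = 0"
  "at_most_one_nonzero [x, y, z] \<longleftrightarrow> x = 0 \<and> y = 0 \<or> x = 0 \<and> z = 0 \<or> y = 0 \<and> z = 0"
  by (auto simp: at_most_one_nonzero_def)

lemma index_sets:
  assumes "n \<in> {6, 7, 8}"
  shows "idx n = idx0 n \<union> idx1 n" "idx0 n \<inter> idx1 n = {}" "kk n \<in> idx1 n"
    "finite (idx0 n)" "finite (idx1 n)"
proof -
  have s: "{1..6::nat} = {1, 2, 3, 4, 5, 6}" "{1..7::nat} = {1, 2, 3, 4, 5, 6, 7}"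
    "{1..8::nat} = {1, 2, 3, 4, 5, 6, 7, 8}"
    by auto
  have "idx 6 = idx0 6 \<union> idx1 6" "idx 7 = idx0 7 \<union> idx1 7" "idx 8 = idx0 8 \<union> idx1 8"
    unfolding idx_def idx0_def idx1_def s by (simp_all add: insert_commute)
  then show "idx n = idx0 n \<union> idx1 n"
    using assms by blast
  show "idx0 n \<inter> idx1 n = {}" "kk n \<in> idx1 n" "finite (idx0 n)" "finite (idx1 n)"
    using assms by (auto simp: idx0_def idx1_def kk_def)
qed

lemma count_sum_local:
  assumes "finite A" "\<And>i. i \<in> A \<Longrightarrow> i \<noteq> j \<Longrightarrow> count (X i) (j, c) = 0"
  shows "count (\<Sum>i\<in>A. X i) (j, c) = (if j \<in> A then count (X j) (j, c) else 0)"
proof -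
  have "count (\<Sum>i\<in>A. X i) (j, c) = (\<Sum>i\<in>A. if i = j then count (X j) (j, c) else 0)"
    unfolding count_sum using assms(2) by (intro sum.cong) auto
  then show ?thesis
    using assms(1) by simp
qed

lemma count_expression:
  assumes "n \<in> {6, 7, 8}"
  shows "count ((\<Sum>i\<in>idx n. repeat_mset (a i) (F n i))
      + (\<Sum>i\<in>idx0 n. repeat_mset (ps i) {#(i, 1)#} + repeat_mset (qs i) {#(i, 3)#})
      + (\<Sum>j\<in>idx1 n - {kk n}. repeat_mset (ps j) {#(j, 2)#} + repeat_mset (qs j) {#(j, 0)#})
      + repeat_mset p {#(kk n, 2), (kk n, 4)#}
      + repeat_mset q {#(kk n, 0), (kk n, 4)#}
      + repeat_mset r {#(kk n, 0), (kk n, 2)#}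
      + repeat_mset s {#(kk n, 0)#} + repeat_mset t {#(kk n, 2)#} + repeat_mset u {#(kk n, 4)#})
      (j, c) =
    (if j \<in> idx0 n then (if c = 1 then a j + ps j else if c = 3 then a j + qs j else 0)
     else if j = kk n then
       (if c = 0 then a j + q + r + s else if c = 2 then a j + p + r + t
        else if c = 4 then a j + p + q + u else 0)
     else if j \<in> idx1 n then (if c = 2 then a j + ps j else if c = 0 then a j + qs j else 0)
     else 0)"
proof -
  note [simp] = index_sets(1,3,4,5)[OF assms]
  have [simp]: "kk n \<notin> idx0 n" "j \<in> idx0 n \<Longrightarrow> j \<notin> idx1 n" "j \<in> idx0 n \<Longrightarrow> j \<noteq> kk n"
    using index_sets(2,3)[OF assms] by auto
  show ?thesis
    by (simp add: count_sum_local F_def)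
qed

lemma expression_counts:
  assumes n: "n \<in> {6, 7, 8}" and "is_expression n m a ps qs p q r s t u"
  shows "i \<in> idx0 n \<Longrightarrow> count m (i, 1) = a i + ps i \<and> count m (i, 3) = a i + qs i"
    "i \<in> idx1 n - {kk n} \<Longrightarrow> count m (i, 2) = a i + ps i \<and> count m (i, 0) = a i + qs i"
    "count m (kk n, 0) = a (kk n) + q + r + s"
    "count m (kk n, 2) = a (kk n) + p + r + t"
    "count m (kk n, 4) = a (kk n) + p + q + u"
proof -
  have m: "count m (j, c) =
    (if j \<in> idx0 n then (if c = 1 then a j + ps j else if c = 3 then a j + qs j else 0)
     else if j = kk n then
       (if c = 0 then a j + q + r + s else if c = 2 then a j + p + r + t
        else if c = 4 then a j + p + q + u else 0)
     else if j \<in> idx1 n then (if c = 2 then a j + ps j else if c = 0 then a j + qs j else 0)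
     else 0)" for j c
    using assms(2) unfolding is_expression_def
    by (elim conjE) (simp only: count_expression[OF n])
  have k: "kk n \<notin> idx0 n" and d: "j \<in> idx1 n \<Longrightarrow> j \<notin> idx0 n" for j
    using index_sets(2,3)[OF n] by auto
  show "i \<in> idx0 n \<Longrightarrow> count m (i, 1) = a i + ps i \<and> count m (i, 3) = a i + qs i"
    "i \<in> idx1 n - {kk n} \<Longrightarrow> count m (i, 2) = a i + ps i \<and> count m (i, 0) = a i + qs i"
    "count m (kk n, 0) = a (kk n) + q + r + s"
    "count m (kk n, 2) = a (kk n) + p + r + t"
    "count m (kk n, 4) = a (kk n) + p + q + u"
    using k d by (simp_all add: m)
qed

lemma expression_special_values:
  fixes e p q r s t u :: nat
  assumes "at_most_one_nonzero [p, q, r]" "at_most_one_nonzero [s, t, u]"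
    "at_most_one_nonzero [p, s]" "at_most_one_nonzero [q, t]" "at_most_one_nonzero [r, u]"
    and "x = e + q + r + s" "y = e + p + r + t" "z = e + p + q + u"
  shows "e = min x (min y z)" "p = min y z - e" "q = min x z - e" "r = min x y - e"
    "s = x - (e + q + r)" "t = y - (e + p + r)" "u = z - (e + p + q)"
  using assms unfolding at_most_one_nonzero_iff by (elim disjE conjE; simp)+

lemma expression_unique:
  assumes n: "n \<in> {6, 7, 8}"
    and e: "is_expression n m a ps qs p q r s t u"
    and e': "is_expression n m a' ps' qs' p' q' r' s' t' u'"
  shows "\<forall>i\<in>idx n. a i = a' i" "\<forall>i\<in>idx n - {kk n}. ps i = ps' i \<and> qs i = qs' i"
    "(p, q, r, s, t, u) = (p', q', r', s', t', u')"
proof -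
  note c = expression_counts[OF n e] and c' = expression_counts[OF n e']
  have am: "at_most_one_nonzero [p, q, r]" "at_most_one_nonzero [s, t, u]"
    "at_most_one_nonzero [p, s]" "at_most_one_nonzero [q, t]" "at_most_one_nonzero [r, u]"
    using e by (simp_all add: is_expression_def)
  have am': "at_most_one_nonzero [p', q', r']" "at_most_one_nonzero [s', t', u']"
    "at_most_one_nonzero [p', s']" "at_most_one_nonzero [q', t']" "at_most_one_nonzero [r', u']"
    using e' by (simp_all add: is_expression_def)
  note v = expression_special_values[OF am c(3-5)]
  note v' = expression_special_values[OF am' c'(3-5)]
  have k0: "a (kk n) = a' (kk n)"
    using v(1) v'(1) by metis
  have k1: "p = p'" "q = q'" "r = r'"
    using v(2-4) v'(2-4) k0 by metis+
  have k: "p = p' \<and> q = q' \<and> r = r' \<and> s = s' \<and> t = t' \<and> u = u' \<and> a (kk n) = a' (kk n)"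
    using v(5-7) v'(5-7) k0 k1 by metis
  have i: "a i = a' i \<and> ps i = ps' i \<and> qs i = qs' i" if "i \<in> idx n - {kk n}" for i
  proof -
    have "ps i = 0 \<or> qs i = 0" "ps' i = 0 \<or> qs' i = 0"
      using that e e' by (auto simp: is_expression_def at_most_one_nonzero_iff)
    moreover have "a i + ps i = a' i + ps' i" "a i + qs i = a' i + qs' i"
      using that c(1,2)[of i] c'(1,2)[of i] unfolding index_sets(1)[OF n] by force+
    ultimately show ?thesis
      by linarith
  qed
  show "\<forall>i\<in>idx n. a i = a' i" "\<forall>i\<in>idx n - {kk n}. ps i = ps' i \<and> qs i = qs' i"
    "(p, q, r, s, t, u) = (p', q', r', s', t', u')"
    using i k by auto
qed

lemma expression_exists_special:
  "\<exists>e p q r s t u :: nat. x = e + q + r + s \<and> y = e + p + r + t \<and> z = e + p + q + u \<and>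
    at_most_one_nonzero [p, q, r] \<and> at_most_one_nonzero [s, t, u] \<and>
    at_most_one_nonzero [p, s] \<and> at_most_one_nonzero [q, t] \<and> at_most_one_nonzero [r, u]"
proof -
  consider "x \<le> y" "x \<le> z" | "y \<le> x" "y \<le> z" | "z \<le> x" "z \<le> y"
    by linarith
  then show ?thesis
  proof cases
    case 1
    show ?thesis
      by (rule exI[of _ x], rule exI[of _ "min y z - x"], rule exI[of _ 0],
          rule exI[of _ 0], rule exI[of _ 0],
          rule exI[of _ "y - min y z"], rule exI[of _ "z - min y z"],
          use 1 in \<open>simp add: at_most_one_nonzero_iff min_def\<close>)
  next
    case 2
    show ?thesis
      by (rule exI[of _ y], rule exI[of _ 0], rule exI[of _ "min x z - y"],
          rule exI[of _ 0], rule exI[of _ "x - min x z"],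
          rule exI[of _ 0], rule exI[of _ "z - min x z"],
          use 2 in \<open>simp add: at_most_one_nonzero_iff min_def\<close>)
  next
    case 3
    show ?thesis
      by (rule exI[of _ z], rule exI[of _ 0], rule exI[of _ 0],
          rule exI[of _ "min x y - z"], rule exI[of _ "x - min x y"],
          rule exI[of _ "y - min x y"], rule exI[of _ 0],
          use 3 in \<open>simp add: at_most_one_nonzero_iff min_def\<close>)
  qed
qed

lemma expression_exists:
  assumes n: "n \<in> {6, 7, 8}" and m: "m \<in> monomials n"
  shows "\<exists>a ps qs p q r s t u. is_expression n m a ps qs p q r s t u"
proof -
  obtain e p q r s t u where
    e: "count m (kk n, 0) = e + q + r + s" "count m (kk n, 2) = e + p + r + t"
      "count m (kk n, 4) = e + p + q + u"
    and am: "at_most_one_nonzero [p, q, r]" "at_most_one_nonzero [s, t, u]"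
      "at_most_one_nonzero [p, s]" "at_most_one_nonzero [q, t]" "at_most_one_nonzero [r, u]"
    using expression_exists_special by metis
  define f where "f i = (if i \<in> idx0 n then count m (i, 1) else count m (i, 2))" for i
  define g where "g i = (if i \<in> idx0 n then count m (i, 3) else count m (i, 0))" for i
  define a where "a i = (if i = kk n then e else min (f i) (g i))" for i
  have k: "kk n \<notin> idx0 n" "kk n \<in> idx1 n"
    using index_sets(2,3)[OF n] by auto
  have z: "count m x = 0" if "x \<notin> vars n" for x
    using m that by (auto simp: monomials_def count_eq_zero_iff)
  have "is_expression n m a (\<lambda>i. f i - g i) (\<lambda>i. g i - f i) p q r s t u"
    unfolding is_expression_def
  proof (intro conjI am ballI)
    show "m = (\<Sum>i\<in>idx n. repeat_mset (a i) (F n i))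
      + (\<Sum>i\<in>idx0 n. repeat_mset (f i - g i) {#(i, 1)#} + repeat_mset (g i - f i) {#(i, 3)#})
      + (\<Sum>j\<in>idx1 n - {kk n}.
          repeat_mset (f j - g j) {#(j, 2)#} + repeat_mset (g j - f j) {#(j, 0)#})
      + repeat_mset p {#(kk n, 2), (kk n, 4)#}
      + repeat_mset q {#(kk n, 0), (kk n, 4)#}
      + repeat_mset r {#(kk n, 0), (kk n, 2)#}
      + repeat_mset s {#(kk n, 0)#} + repeat_mset t {#(kk n, 2)#} + repeat_mset u {#(kk n, 4)#}"
      (is "m = ?rhs")
    proof (rule multiset_eqI, clarify)
      fix j c
      show "count m (j, c) = count ?rhs (j, c)"
        unfolding count_expression[OF n] using k e z[of "(j, c)"] index_sets(2)[OF n]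
        by (auto simp: vars_def a_def f_def g_def)
    qed
  qed (auto simp: at_most_one_nonzero_iff)
  then show ?thesis
    by blast
qed

text \<open>
  By \<open>expression_exists\<close> and \<open>expression_unique\<close>, every monomial has an expression, unique up
  to the values of the families outside their index sets, on which \<open>G_value\<close> does not depend.
\<close>

definition G :: "nat \<Rightarrow> monomial \<Rightarrow> (nat \<Rightarrow>\<^sub>0 int)"
  where "G n m = (THE x. \<exists>a ps qs p q r s t u.
    is_expression n m a ps qs p q r s t u \<and> x = G_value n ps qs p q r s t u)"

definition G' :: "nat \<Rightarrow> monomial \<Rightarrow> (nat \<Rightarrow>\<^sub>0 int)"
  where "G' n = restrict (G n) (monomials' n)"

end

theory Submission
  imports Defs
begin

text \<open>
  For a monomial that no \<open>F n i\<close> divides, the exponents of the \<open>F n i\<close> in its expression vanish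
  (\<open>F_dvd_iff_exponent_pos\<close>), so it is given by the remaining exponents, and bijectivity has to
  be checked on these.

  The value of \<open>G\<close> at \<open>\<alpha>\<^sub>i\<close> with \<open>i\<close> different from \<open>0\<close>, \<open>k\<close>, \<open>k'\<close> is \<open>q\<^sub>i - p\<^sub>i\<close>, and an
  integer is such a difference with \<open>p\<^sub>i = 0\<close> or \<open>q\<^sub>i = 0\<close> in exactly one way.
  The coefficients \<open>A\<close> at \<open>\<alpha>\<^sub>0\<close> and \<open>B\<close> at \<open>\<alpha>\<^sub>k\<close> involve only \<open>p, q, r, s, t, u\<close>:
  \<open>(A, B) = p (-1, 0) + q (1, 2) + r (1, 0) + s (1, 1) + t (0, -1) + u (0, 1)\<close>.
  The side conditions allow exactly the pairs \<open>pt\<close>, \<open>pu\<close>, \<open>qs\<close>, \<open>qu\<close>, \<open>rs\<close>, \<open>rt\<close> to be nonzero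
  together. These are pairs of neighbours among the six vectors ordered by angle, each pair is a
  basis of the lattice, and the six cones form a complete fan in the plane. So every \<open>(A, B)\<close> is
  hit exactly once (\<open>fan_coordinates_unique\<close> and \<open>fan_coordinates_exist\<close>).
  Finally, the coefficient at index \<open>i = k'\<close> is \<open>q\<^sub>i - p\<^sub>i + q + u\<close>, where the shift \<open>q + u\<close> is
  already determined by \<open>A\<close> and \<open>B\<close>: the system is triangular.
\<close>

section \<open>A complete unimodular fan with six cones\<close>

text \<open>
  Each coordinate is the function that is linear on every cone, \<open>1\<close> at its own ray generator and
  \<open>0\<close> at the other five. For \<open>p\<close> and \<open>t\<close>, whose two neighbouring generators are opposite, this is
  the positive part of one linear form; for the others, of the minimum of two.
\<close>

lemma fan_coordinates_unique:
  fixes p q r s t u :: nat and A B :: int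
  assumes "at_most_one_nonzero [p, q, r]" "at_most_one_nonzero [s, t, u]"
    "at_most_one_nonzero [p, s]" "at_most_one_nonzero [q, t]" "at_most_one_nonzero [r, u]"
    and "A = int q + int r + int s - int p" "B = 2 * int q + int s + int u - int t"
  shows "p = nat (- A)" "q = nat (min A (B - A))" "r = nat (min A (A - B))"
    "s = nat (min B (2 * A - B))" "t = nat (- B)" "u = nat (min B (B - 2 * A))"
  using assms unfolding at_most_one_nonzero_iff by (elim disjE conjE; simp)+

lemma fan_coordinates_exist:
  fixes A B :: int
  obtains p q r s t u :: nat where
    "at_most_one_nonzero [p, q, r]" "at_most_one_nonzero [s, t, u]"
    "at_most_one_nonzero [p, s]" "at_most_one_nonzero [q, t]" "at_most_one_nonzero [r, u]"
    "A = int q + int r + int s - int p" "B = 2 * int q + int s + int u - int t"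
proof
  let ?p = "nat (- A)" and ?q = "nat (min A (B - A))" and ?r = "nat (min A (A - B))"
    and ?s = "nat (min B (2 * A - B))" and ?t = "nat (- B)" and ?u = "nat (min B (B - 2 * A))"
  show "at_most_one_nonzero [?p, ?q, ?r]" "at_most_one_nonzero [?s, ?t, ?u]"
    "at_most_one_nonzero [?p, ?s]" "at_most_one_nonzero [?q, ?t]" "at_most_one_nonzero [?r, ?u]"
    unfolding at_most_one_nonzero_iff by linarith+
  show "A = int ?q + int ?r + int ?s - int ?p" "B = 2 * int ?q + int ?s + int ?u - int ?t"
    by linarith+
qed

section \<open>Expressions and their values\<close>

lemma kk_kk'_idx:
  assumes "n \<in> {6, 7, 8}"
  shows "kk n \<in> idx n" "kk' n \<in> idx n" "kk' n \<noteq> kk n"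
  using assms by (auto simp: kk_def kk'_def idx_def)

lemma lookup_G_value:
  assumes "n \<in> {6, 7, 8}"
  shows "Poly_Mapping.lookup (G_value n ps qs p q r s t u) i =
    (if i = 0 then int q + int r + int s - int p
     else if i = kk n then 2 * int q + int s + int u - int t
     else (if i \<in> idx n then int (qs i) - int (ps i) else 0)
       + (if i = kk' n then int q + int u else 0))"
proof -
  have "Poly_Mapping.lookup
      (\<Sum>i\<in>idx n - {kk n}. frag_cmul (int (qs i) - int (ps i)) (frag_of i)) i =
    (\<Sum>j\<in>idx n - {kk n}. if j = i then int (qs i) - int (ps i) else 0)"
    unfolding lookup_sum by (intro sum.cong) (auto simp: lookup_single when_def)
  also have "\<dots> = (if i \<in> idx n - {kk n} then int (qs i) - int (ps i) else 0)"
    by (simp add: idx_def)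
  finally show ?thesis
    using kk_kk'_idx[OF assms]
    by (auto simp: G_value_def lookup_add lookup_minus lookup_single lookup_one when_def idx_def)
qed

lemma G_eq_G_value:
  assumes n: "n \<in> {6, 7, 8}" and e: "is_expression n m a ps qs p q r s t u"
  shows "G n m = G_value n ps qs p q r s t u"
  unfolding G_def
proof (rule the_equality)
  show "\<exists>a' ps' qs' p' q' r' s' t' u'. is_expression n m a' ps' qs' p' q' r' s' t' u' \<and>
    G_value n ps qs p q r s t u = G_value n ps' qs' p' q' r' s' t' u'"
    using e by blast
next
  fix x
  assume "\<exists>a' ps' qs' p' q' r' s' t' u'. is_expression n m a' ps' qs' p' q' r' s' t' u' \<and>
    x = G_value n ps' qs' p' q' r' s' t' u'"
  then obtain a' ps' qs' p' q' r' s' t' u' where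
    e': "is_expression n m a' ps' qs' p' q' r' s' t' u'"
    and x: "x = G_value n ps' qs' p' q' r' s' t' u'"
    by blast
  from expression_unique(2,3)[OF n e e'] show "x = G_value n ps qs p q r s t u"
    unfolding x G_value_def
    by (auto intro!: arg_cong2[where f = "(+)"] arg_cong2[where f = "(-)"] sum.cong)
qed

text \<open>
  What remains of an expression after removing the powers of the \<open>F n i\<close> contains no full \<open>F n i\<close>:
  for \<open>i \<noteq> k\<close> because \<open>p\<^sub>i = 0\<close> or \<open>q\<^sub>i = 0\<close>, and for \<open>i = k\<close> because each of the six
  admissible pairs of exponents misses one of the three indeterminates.
\<close>

lemma F_dvd_iff_exponent_pos:
  assumes n: "n \<in> {6, 7, 8}" and e: "is_expression n m a ps qs p q r s t u" and i: "i \<in> idx n"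
  shows "F n i \<subseteq># m \<longleftrightarrow> 0 < a i"
proof -
  note c = expression_counts[OF n e]
  have k: "kk n \<notin> idx0 n" "kk n \<in> idx1 n"
    using index_sets(2,3)[OF n] by auto
  have pair: "{#x, y#} \<subseteq># m \<longleftrightarrow> 0 < count m x \<and> 0 < count m y" if "x \<noteq> y" for x y
    using that by (auto simp: insert_subset_eq_iff in_diff_count count_greater_zero_iff)
  have triple: "{#x, y, z#} \<subseteq># m \<longleftrightarrow> 0 < count m x \<and> 0 < count m y \<and> 0 < count m z"
    if "x \<noteq> y" "x \<noteq> z" "y \<noteq> z" for x y z
    using that by (auto simp: insert_subset_eq_iff in_diff_count count_greater_zero_iff)
  show ?thesis
  proof (cases "i = kk n")
    case True
    have "F n i \<subseteq># m \<longleftrightarrow>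
      0 < a (kk n) + q + r + s \<and> 0 < a (kk n) + p + r + t \<and> 0 < a (kk n) + p + q + u"
      using k True c(3-5) by (simp add: F_def triple)
    also have "\<dots> \<longleftrightarrow> 0 < a i"
      using e True unfolding is_expression_def at_most_one_nonzero_iff by auto
    finally show ?thesis .
  next
    case False
    then have z: "ps i = 0 \<or> qs i = 0"
      using e i by (auto simp: is_expression_def at_most_one_nonzero_iff)
    show ?thesis
    proof (cases "i \<in> idx0 n")
      case True
      then show ?thesis
        using c(1)[of i] z by (auto simp: F_def pair)
    next
      case i0: False
      then have "i \<in> idx1 n - {kk n}"
        using False i index_sets(1)[OF n] by auto
      then show ?thesis
        using c(2)[of i] z i0 False by (auto simp: F_def pair)
    qed
  qed
qed

lemma monomials'_expression:
  assumes n: "n \<in> {6, 7, 8}" and m: "m \<in> monomials' n"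
  obtains a ps qs p q r s t u where
    "is_expression n m a ps qs p q r s t u" "\<And>i. i \<in> idx n \<Longrightarrow> a i = 0"
proof -
  obtain a ps qs p q r s t u where e: "is_expression n m a ps qs p q r s t u"
    using expression_exists[OF n, of m] m unfolding monomials'_def by blast
  moreover have "a i = 0" if "i \<in> idx n" for i
    using F_dvd_iff_exponent_pos[OF n e that] m that by (simp add: monomials'_def)
  ultimately show ?thesis
    using that by blast
qed

text \<open>
  Surjectivity needs a converse of \<open>monomials'_expression\<close>: every choice of exponents subject to
  the side conditions comes from a monomial, which is the product that they describe.
\<close>

lemma expression_in_monomials':
  assumes n: "n \<in> {6, 7, 8}"
    and am: "\<forall>i\<in>idx n - {kk n}. at_most_one_nonzero [ps i, qs i]"
    "at_most_one_nonzero [p, q, r]" "at_most_one_nonzero [s, t, u]"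
    "at_most_one_nonzero [p, s]" "at_most_one_nonzero [q, t]" "at_most_one_nonzero [r, u]"
  obtains m where "m \<in> monomials' n" "is_expression n m (\<lambda>_. 0) ps qs p q r s t u"
proof -
  define m where "m = (\<Sum>i\<in>idx n. repeat_mset ((\<lambda>_. 0) i) (F n i))
      + (\<Sum>i\<in>idx0 n. repeat_mset (ps i) {#(i, 1)#} + repeat_mset (qs i) {#(i, 3)#})
      + (\<Sum>j\<in>idx1 n - {kk n}. repeat_mset (ps j) {#(j, 2)#} + repeat_mset (qs j) {#(j, 0)#})
      + repeat_mset p {#(kk n, 2), (kk n, 4)#}
      + repeat_mset q {#(kk n, 0), (kk n, 4)#}
      + repeat_mset r {#(kk n, 0), (kk n, 2)#}
      + repeat_mset s {#(kk n, 0)#} + repeat_mset t {#(kk n, 2)#} + repeat_mset u {#(kk n, 4)#}"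
  have e: "is_expression n m (\<lambda>_. 0) ps qs p q r s t u"
    unfolding is_expression_def using am m_def by blast
  have "x \<in> vars n" if "x \<in># m" for x
  proof (cases x)
    case (Pair j c)
    have "count m (j, c) \<noteq> 0"
      using that Pair by simp
    then show ?thesis
      unfolding m_def count_expression[OF n] using Pair index_sets(3)[OF n]
      by (auto simp: vars_def split: if_splits)
  qed
  then have "m \<in> monomials' n"
    using F_dvd_iff_exponent_pos[OF n e] by (auto simp: monomials'_def monomials_def)
  then show ?thesis
    using e that by blast
qed

section \<open>Bijectivity\<close>

lemma G_value_in_root_lattice:
  assumes "n \<in> {6, 7, 8}"
  shows "G_value n ps qs p q r s t u \<in> root_lattice n"
proof -
  have "i \<in> {0..n}" if "Poly_Mapping.lookup (G_value n ps qs p q r s t u) i \<noteq> 0" for i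
    using that kk_kk'_idx[OF assms] unfolding lookup_G_value[OF assms]
    by (auto simp: idx_def split: if_splits)
  then show ?thesis
    by (auto simp: root_lattice_def in_keys_iff)
qed

lemma inj_on_G_monomials':
  assumes n: "n \<in> {6, 7, 8}"
  shows "inj_on (G n) (monomials' n)"
proof (rule inj_onI)
  fix m m'
  assume m: "m \<in> monomials' n" and m': "m' \<in> monomials' n" and eq: "G n m = G n m'"
  obtain a ps qs p q r s t u where e: "is_expression n m a ps qs p q r s t u"
    and a: "\<And>i. i \<in> idx n \<Longrightarrow> a i = 0"
    using monomials'_expression[OF n m] by blast
  obtain a' ps' qs' p' q' r' s' t' u' where e': "is_expression n m' a' ps' qs' p' q' r' s' t' u'"
    and a': "\<And>i. i \<in> idx n \<Longrightarrow> a' i = 0"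
    using monomials'_expression[OF n m'] by blast
  have am: "at_most_one_nonzero [p, q, r]" "at_most_one_nonzero [s, t, u]"
    "at_most_one_nonzero [p, s]" "at_most_one_nonzero [q, t]" "at_most_one_nonzero [r, u]"
    using e by (simp_all add: is_expression_def)
  have am': "at_most_one_nonzero [p', q', r']" "at_most_one_nonzero [s', t', u']"
    "at_most_one_nonzero [p', s']" "at_most_one_nonzero [q', t']" "at_most_one_nonzero [r', u']"
    using e' by (simp_all add: is_expression_def)
  have v: "Poly_Mapping.lookup (G_value n ps qs p q r s t u) i =
      Poly_Mapping.lookup (G_value n ps' qs' p' q' r' s' t' u') i" for i
    using eq by (simp add: G_eq_G_value[OF n e] G_eq_G_value[OF n e'])
  have "int q + int r + int s - int p = int q' + int r' + int s' - int p'"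
    using v[of 0] by (simp add: lookup_G_value[OF n])
  moreover have "2 * int q + int s + int u - int t = 2 * int q' + int s' + int u' - int t'"
    using v[of "kk n"] kk_kk'_idx(1)[OF n] by (simp add: lookup_G_value[OF n] idx_def)
  ultimately have k: "p = p'" "q = q'" "r = r'" "s = s'" "t = t'" "u = u'"
    using fan_coordinates_unique[OF am refl refl] fan_coordinates_unique[OF am' refl refl]
    by metis+
  have i: "ps i = ps' i \<and> qs i = qs' i" if "i \<in> idx n - {kk n}" for i
  proof -
    have "int (qs i) - int (ps i) = int (qs' i) - int (ps' i)"
      using v[of i] that k by (simp add: lookup_G_value[OF n] idx_def split: if_splits)
    moreover have "ps i = 0 \<or> qs i = 0" "ps' i = 0 \<or> qs' i = 0"
      using that e e' by (auto simp: is_expression_def at_most_one_nonzero_iff)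
    ultimately show ?thesis
      by linarith
  qed
  have I: "idx0 n \<subseteq> idx n - {kk n}" "idx1 n \<subseteq> idx n" "kk n \<in> idx n"
    using index_sets(1-3)[OF n] by auto
  show "m = m'"
  proof (rule multiset_eqI, clarify)
    fix j c
    show "count m (j, c) = count m' (j, c)"
      using e[unfolded is_expression_def, THEN conjunct1]
        e'[unfolded is_expression_def, THEN conjunct1]
      by (simp only: count_expression[OF n])
        (use I i[of j] a[of j] a'[of j] k in \<open>auto\<close>)
  qed
qed

lemma root_lattice_subset_G_image:
  assumes n: "n \<in> {6, 7, 8}"
  shows "root_lattice n \<subseteq> G n ` monomials' n"
proof
  fix x
  assume x: "x \<in> root_lattice n"
  let ?x = "Poly_Mapping.lookup x"
  obtain p q r s t u :: nat where
    am: "at_most_one_nonzero [p, q, r]" "at_most_one_nonzero [s, t, u]"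
    "at_most_one_nonzero [p, s]" "at_most_one_nonzero [q, t]" "at_most_one_nonzero [r, u]"
    and A: "?x 0 = int q + int r + int s - int p"
    and B: "?x (kk n) = 2 * int q + int s + int u - int t"
    by (rule fan_coordinates_exist)
  \<comment> \<open>The coefficient left for \<open>q\<^sub>i - p\<^sub>i\<close> once \<open>q\<close> and \<open>u\<close> are known.\<close>
  define y where "y i = ?x i - (if i = kk' n then int q + int u else 0)" for i
  have "\<forall>i\<in>idx n - {kk n}. at_most_one_nonzero [nat (- y i), nat (y i)]"
    by (auto simp: at_most_one_nonzero_iff)
  then obtain m where m: "m \<in> monomials' n"
    and e: "is_expression n m (\<lambda>_. 0) (\<lambda>i. nat (- y i)) (\<lambda>i. nat (y i)) p q r s t u"
    by (rule expression_in_monomials'[OF n _ am])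
  have "?x i = 0" if "i \<notin> idx n" "i \<noteq> 0" for i
    using x that by (auto simp: root_lattice_def idx_def in_keys_iff)
  then have "G_value n (\<lambda>i. nat (- y i)) (\<lambda>i. nat (y i)) p q r s t u = x"
    using A B kk_kk'_idx[OF n] by (intro poly_mapping_eqI) (auto simp: lookup_G_value[OF n] y_def)
  then show "x \<in> G n ` monomials' n"
    using m G_eq_G_value[OF n e] by force
qed

theorem proposition5p20:
  fixes n :: nat
  assumes "n \<in> {6, 7, 8}"
  shows "bij_betw (G' n) (monomials' n) (root_lattice n)"
proof -
  have "G n m \<in> root_lattice n" if "m \<in> monomials' n" for m
    using monomials'_expression[OF assms that] G_eq_G_value[OF assms]
      G_value_in_root_lattice[OF assms] by metis
  then have "bij_betw (G n) (monomials' n) (root_lattice n)"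
    using inj_on_G_monomials'[OF assms] root_lattice_subset_G_image[OF assms]
    by (auto simp: bij_betw_def)
  then show ?thesis
    by (simp add: G'_def cong: bij_betw_cong)
qed

end
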